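(* For every $\delta > 0$ there exists a constant $L$ such that for all positive integers $s \ge L$ and $k \ge Ls$, \[ r(s,k) \ge \left(\frac{k}{s}\right)^{(1-\delta)s}. \]
   Context: For positive integers $s,k$, the Ramsey number $r(s,k)$ is the minimum integer $n$ such that every graph on $n$ vertices contains a clique of size $s$ or an independent set of size $k$. *)

theory Defs
  imports "HOL-Analysis.Analysis"
begin

definition is_clique :: "('a \<Rightarrow> 'a \<Rightarrow> bool) \<Rightarrow> 'a set \<Rightarrow> bool" where
  "is_clique E S \<longleftrightarrow> (\<forall>x\<in>S. \<forall>y\<in>S. x \<noteq> y \<longrightarrow> E x y)"

definition is_indep :: "('a \<Rightarrow> 'a \<Rightarrow> bool) \<Rightarrow> 'a set \<Rightarrow> bool" where
  "is_indep E S \<longleftrightarrow> (\<forall>x\<in>S. \<forall>y\<in>S. x \<noteq> y \<longrightarrow> \<not> E x y)"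

definition simple_graph :: "'a set \<Rightarrow> ('a \<Rightarrow> 'a \<Rightarrow> bool) \<Rightarrow> bool" where
  "simple_graph V E \<longleftrightarrow> (\<forall>x\<in>V. \<forall>y\<in>V. E x y \<longrightarrow> E y x) \<and> (\<forall>x\<in>V. \<not> E x x)"

definition ramsey_property :: "nat \<Rightarrow> nat \<Rightarrow> nat \<Rightarrow> bool" where
  "ramsey_property s k n \<longleftrightarrow>
     (\<forall>E :: nat \<Rightarrow> nat \<Rightarrow> bool. simple_graph {..<n} E \<longrightarrow>
        (\<exists>S\<subseteq>{..<n}. card S = s \<and> is_clique E S) \<or>
        (\<exists>S\<subseteq>{..<n}. card S = k \<and> is_indep E S))"

definition ramsey_number :: "nat \<Rightarrow> nat \<Rightarrow> nat" where
  "ramsey_number s k = (LEAST n. ramsey_property s k n)"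

end

theory Submission
  imports Defs "HOL-Computational_Algebra.Computational_Algebra" "HOL-Real_Asymp.Real_Asymp" "HOL-Library.Ramsey"
begin

text \<open>Fix a prime \<open>p\<close> slightly smaller than \<open>k / s\<close> and let \<open>m = s - 2\<close>. Give every vertex \<open>i\<close> a random pair
  of an affine form \<open>x\<^sub>i\<close> on \<open>F\<^sub>p\<^sup>m\<close> and a point \<open>y\<^sub>i\<close> with \<open>x\<^sub>i(y\<^sub>i) \<noteq> 0\<close>, and join \<open>i < j\<close> iff
  \<open>x\<^sub>i(y\<^sub>j) = 0\<close>. On a clique the matrix \<open>x\<^sub>i(y\<^sub>j)\<close> is triangular with nonzero diagonal, and affine
  forms span a space of dimension \<open>m + 1\<close>, so there is no clique of size \<open>s\<close>. For independent sets,
  follow the set \<open>C\<close> of points at which no earlier form vanishes. A new form either removes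
  a proportion at least \<open>1/(2p)\<close> of \<open>C\<close>, which happens only about \<open>2pm ln p\<close> times, much less than \<open>k\<close>;
  or it is one of the exceptional forms for \<open>C\<close>. By Chebyshev's inequality the product of \<open>|C|\<close> and the
  number of exceptional forms is at most \<open>4p\<^sup>m\<^sup>+\<^sup>2\<close>, so that such a step has probability about \<open>p\<^sup>1\<^sup>-\<^sup>m\<close>.
  Hence \<open>k\<close> vertices are independent with probability roughly \<open>p\<close> to the power \<open>-mk(1 - o(1))\<close>, and a
  union bound allows about \<open>p\<^sup>m\<close> vertices.\<close>

section \<open>Primes in \<open>[N\<^sup>1\<^sup>-\<^sup>e, N]\<close>\<close>

text \<open>The numbers \<open>1 / ((n + 1) (n choose j))\<close> form Leibniz' harmonic triangle, in which each entry is
  the sum of the two below it.\<close>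
lemma Lcm_over_binomial_Ints:
  assumes "j \<le> n"
  shows "real (Lcm {1..Suc n}) / (real (Suc n) * real (n choose j)) \<in> \<int>"
  using assms
proof (induction n arbitrary: j)
  case 0
  then show ?case by simp
next
  case (Suc n)
  let ?D = "Lcm {1..Suc (Suc n)}"
  have dvd_div: "real ?D / real q \<in> \<int>" if "q dvd ?D" for q
    using that by (metis Ints_of_nat real_of_nat_div)
  from Suc.prems show ?case
  proof (induction j)
    case 0
    have "Suc (Suc n) dvd ?D" by (rule dvd_Lcm) auto
    from dvd_div[OF this] show ?case by simp
  next
    case (Suc j)
    have "Lcm {1..Suc n} dvd ?D"
      by (rule Lcm_subset) auto
    then obtain c where c: "?D = Lcm {1..Suc n} * c" by (elim dvdE)
    have "real c * (real (Lcm {1..Suc n}) / (real (Suc n) * real (n choose j))) \<in> \<int>"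
      using Suc.prems \<open>\<And>j. j \<le> n \<Longrightarrow> _\<close> by (intro Ints_mult) auto
    then have I1: "real ?D / (real (Suc n) * real (n choose j)) \<in> \<int>"
      unfolding c by (simp only: of_nat_mult times_divide_eq_right mult.commute)
    have I2: "real ?D / (real (Suc (Suc n)) * real (Suc n choose j)) \<in> \<int>"
      using Suc by simp
    \<comment> \<open>The triangle recurrence is checked by writing all three entries over the
      denominator \<open>(n + 2) * (n + 1) * (n choose j)\<close>; the numerators are then
      \<open>j + 1\<close>, \<open>n + 1 - j\<close> and \<open>n + 2\<close>.\<close>
    have cancel: "1 / (a * y) = c / (a * (c * y))" if "c \<noteq> 0" for a c y :: real
      using that by (cases "a = 0 \<or> y = 0") (auto simp: field_simps)
    have e1: "real (Suc j) * real (Suc n choose Suc j) = real (Suc n) * real (n choose j)"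
      using Suc_times_binomial[of j n] by (metis of_nat_mult)
    have "(Suc n - j) * (Suc n choose j) = Suc n * (n choose j)"
      using binomial_absorb_comp[of "Suc n" j] by simp
    then have e2: "(real (Suc n) - real j) * real (Suc n choose j) = real (Suc n) * real (n choose j)"
      using Suc.prems by (metis Suc_leD of_nat_diff of_nat_mult)
    have "1 / (real (Suc (Suc n)) * real (Suc n choose Suc j)) =
          real (Suc j) / (real (Suc (Suc n)) * (real (Suc n) * real (n choose j)))"
      unfolding e1[symmetric] by (rule cancel) simp
    moreover have "1 / (real (Suc (Suc n)) * real (Suc n choose j)) =
          (real (Suc n) - real j) / (real (Suc (Suc n)) * (real (Suc n) * real (n choose j)))"
      unfolding e2[symmetric] using Suc.prems by (intro cancel) simp
    moreover have "1 / (real (Suc n) * real (n choose j)) =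
        real (Suc (Suc n)) / (real (Suc (Suc n)) * (real (Suc n) * real (n choose j)))"
      by simp
    ultimately have "1 / (real (Suc (Suc n)) * real (Suc n choose Suc j)) =
       1 / (real (Suc n) * real (n choose j)) - 1 / (real (Suc (Suc n)) * real (Suc n choose j))"
      by (simp only: diff_divide_distrib[symmetric]) simp
    then have "real ?D * (1 / (real (Suc (Suc n)) * real (Suc n choose Suc j))) =
       real ?D * (1 / (real (Suc n) * real (n choose j)) - 1 / (real (Suc (Suc n)) * real (Suc n choose j)))"
      by (rule arg_cong)
    then have "real ?D / (real (Suc (Suc n)) * real (Suc n choose Suc j)) =
       real ?D / (real (Suc n) * real (n choose j)) - real ?D / (real (Suc (Suc n)) * real (Suc n choose j))"
      by (simp only: right_diff_distrib times_divide_eq_right mult_1_right)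
    then show ?case
      using I1 I2 by (simp only: Ints_diff)
  qed
qed

text \<open>Each \<open>(n + 1) * (n choose j)\<close> divides the Lcm, since the quotient is an
  integer, and hence is at most the Lcm. Averaging over the \<open>n + 1\<close> values of
  \<open>j\<close> turns the row sum \<open>2 ^ n\<close> into the bound.\<close>

lemma Lcm_upto_ge: "2 ^ n \<le> Lcm {1..Suc n}"
proof -
  let ?D = "Lcm {1..Suc n}"
  have D: "0 < ?D"
    by (metis Lcm_0_iff_nat atLeastAtMost_iff finite_atLeastAtMost gr0I not_one_le_zero)
  have "real (Suc n) * real (n choose j) \<le> real ?D" if "j \<le> n" for j
  proof -
    have b: "0 < n choose j" using that by simp
    have q: "0 < real ?D / (real (Suc n) * real (n choose j))"
      using D b by (intro divide_pos_pos mult_pos_pos) auto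
    moreover have "real ?D / (real (Suc n) * real (n choose j)) \<in> \<int>"
      by (rule Lcm_over_binomial_Ints[OF that])
    ultimately have "1 \<le> real ?D / (real (Suc n) * real (n choose j))"
      by (elim Ints_cases) simp
    moreover have "0 < real (Suc n) * real (n choose j)" 
      using b by (intro mult_pos_pos) auto
    ultimately show ?thesis
      by (simp only: le_divide_eq_1_pos)
  qed
  then have "(\<Sum>j\<le>n. real (Suc n) * real (n choose j)) \<le> (\<Sum>j\<le>n. real ?D)"
    by (intro sum_mono) auto
  moreover have "(\<Sum>j\<le>n. real (Suc n) * real (n choose j)) = real (Suc n) * real (2 ^ n)"
    by (simp only: sum_distrib_left[symmetric] of_nat_sum[symmetric] choose_row_sum)
  moreover have "(\<Sum>j\<le>n. real ?D) = real (Suc n) * real ?D" by simp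
  ultimately have "real (Suc n) * real (2 ^ n) \<le> real (Suc n) * real ?D" by simp
  then show ?thesis
    by (metis mult_le_cancel_left_pos of_nat_0_less_iff of_nat_le_iff zero_less_Suc)
qed

text \<open>The Lcm divides the product, over the primes up to \<open>n\<close>, of the largest
  power of each prime that is at most \<open>n\<close>; every factor of this product is at most
  \<open>n\<close>.\<close>

lemma Lcm_upto_le:
  fixes n :: nat
  shows "Lcm {1..n} \<le> n ^ card {p. prime p \<and> p \<le> n}"
proof (cases "n = 0")
  case True
  then have no: "{p. prime p \<and> p \<le> n} = {}" by auto
  show ?thesis unfolding no using True by simp
next
  case False
  let ?P = "{p. prime p \<and> p \<le> n}"
  have fin: "finite ?P" by (rule finite_subset[of _ "{..n}"]) auto
  define e where "e p = (GREATEST j. p ^ j \<le> n)" for p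
  \<comment> \<open>Since \<open>j < p ^ j\<close>, the admissible exponents are bounded, which
    makes \<open>GREATEST\<close> in \<open>e\<close> meaningful.\<close>
  have bd: "j \<le> n" if "prime p" "p ^ j \<le> n" for p j :: nat
    using that by (meson le_trans less_imp_le less_exp power_mono prime_ge_2_nat zero_le)
  have e1: "p ^ e p \<le> n" if "prime p" for p
    unfolding e_def using False bd[OF that]
    by (intro GreatestI_nat[where P = "\<lambda>j. p ^ j \<le> n" and k = 0 and b = n]) auto
  have e2: "j \<le> e p" if "prime p" "p ^ j \<le> n" for p j
    unfolding e_def using that bd[OF that(1)]
    by (intro Greatest_le_nat[where P = "\<lambda>j. p ^ j \<le> n" and b = n]) auto
  have "Lcm {1..n} dvd (\<Prod>p\<in>?P. p ^ e p)"
  proof (rule Lcm_least)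
    fix i assume i: "i \<in> {1..n}"
    have "i = (\<Prod>p\<in>prime_factors i. p ^ multiplicity p i)"
      using i by (intro prime_factorization_nat) auto
    also have "\<dots> dvd (\<Prod>p\<in>?P. p ^ multiplicity p i)"
      using i fin by (intro prod_dvd_prod_subset) (auto simp: in_prime_factors_iff dest!: dvd_imp_le)
    also have "\<dots> dvd (\<Prod>p\<in>?P. p ^ e p)"
    proof (intro prod_dvd_prod le_imp_power_dvd)
      fix p assume "p \<in> ?P"
      moreover have "p ^ multiplicity p i \<le> n"
        using i multiplicity_dvd[of p i] by (auto dest!: dvd_imp_le)
      ultimately show "multiplicity p i \<le> e p" using e2 by auto
    qed
    finally show "i dvd (\<Prod>p\<in>?P. p ^ e p)" .
  qed
  then have "Lcm {1..n} \<le> (\<Prod>p\<in>?P. p ^ e p)"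
    by (rule dvd_imp_le) (auto intro!: prod_pos simp: prime_gt_0_nat)
  also have "\<dots> \<le> (\<Prod>p\<in>?P. n)"
    by (intro prod_mono) (use e1 in auto)
  finally show ?thesis by simp
qed

text \<open>If the interval held no prime, there would be at most \<open>N powr (1 - e)\<close>
  primes up to \<open>N\<close>. The two Lcm bounds then give
  \<open>n * ln 2 \<le> N powr (1 - e) * ln N\<close> with \<open>n\<close> within 2 of
  \<open>N\<close>, impossible for large \<open>N\<close>.\<close>

lemma eventually_prime_in_powr_interval:
  fixes e :: real
  assumes "0 < e"
  shows "\<forall>\<^sub>F N :: real in at_top. \<exists>p :: nat. prime p \<and> N powr (1 - e) \<le> real p \<and> real p \<le> N"
proof -
  have "\<forall>\<^sub>F N :: real in at_top. N powr (1 - e) * ln N < (N - 2) * ln 2"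
    using assms by real_asymp
  moreover have "\<forall>\<^sub>F N :: real in at_top. N \<ge> 2" by (rule eventually_ge_at_top)
  ultimately show ?thesis
  proof eventually_elim
    case (elim N)
    show ?case
    proof (rule ccontr)
      assume no: "\<not> (\<exists>p :: nat. prime p \<and> N powr (1 - e) \<le> real p \<and> real p \<le> N)"
      \<comment> \<open>The shift by one makes \<open>Suc n\<close> the floor of \<open>N\<close>,
        as the lower Lcm bound speaks of \<open>Suc n\<close>.\<close>
      define n where "n = nat \<lfloor>N\<rfloor> - 1"
      have n: "real (Suc n) \<le> N" "N - 2 \<le> real n" using elim unfolding n_def by linarith+
      let ?P = "{p. prime p \<and> p \<le> Suc n}"
      have "?P \<subseteq> {1..nat \<lfloor>N powr (1 - e)\<rfloor>}"
      proof
        fix p assume p: "p \<in> ?P"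
        then have "real p \<le> N" using n by simp
        then have "real p < N powr (1 - e)" using no p by (simp only: mem_Collect_eq) (metis not_le)
        then have "p \<le> nat \<lfloor>N powr (1 - e)\<rfloor>" by linarith
        with p show "p \<in> {1..nat \<lfloor>N powr (1 - e)\<rfloor>}" by (auto dest: prime_ge_1_nat)
      qed
      then have "card ?P \<le> nat \<lfloor>N powr (1 - e)\<rfloor>"
        using card_mono[of "{1..nat \<lfloor>N powr (1 - e)\<rfloor>}" ?P] by simp
      then have P: "real (card ?P) \<le> N powr (1 - e)"
        by (meson of_nat_floor of_nat_le_iff order_trans powr_ge_zero)
      have "2 ^ n \<le> Suc n ^ card ?P"
        using Lcm_upto_ge Lcm_upto_le by (rule order_trans)
      then have "real 2 ^ n \<le> real (Suc n) ^ card ?P"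
        by (metis of_nat_le_iff of_nat_power)
      also have "\<dots> \<le> N ^ card ?P" using n by (intro power_mono) auto
      finally have "ln (2 ^ n) \<le> ln (N ^ card ?P)" using elim by simp
      then have "real n * ln 2 \<le> real (card ?P) * ln N" using elim by (simp add: ln_realpow)
      also have "\<dots> \<le> N powr (1 - e) * ln N" using P elim by (intro mult_right_mono) auto
      also have "\<dots> < (N - 2) * ln 2" by (rule elim)
      also have "\<dots> \<le> real n * ln 2" using n by (intro mult_right_mono) auto
      finally show False by simp
    qed
  qed
qed

section \<open>Sequences without vanishing pairs\<close>

text \<open>These lists are the labels of an independent set read in increasing order of vertices.
  The parameter \<open>C\<close>, the set of points still allowed, is there for the recursion on the
  first entry.\<close>

definition nonvanishing_seqs :: "('x \<times> 'y) set \<Rightarrow> ('x \<Rightarrow> 'y \<Rightarrow> bool) \<Rightarrow> nat \<Rightarrow> 'y set \<Rightarrow> ('x \<times> 'y) list set" where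
  "nonvanishing_seqs W Z k C = {l. length l = k \<and> set l \<subseteq> W \<and> snd ` set l \<subseteq> C \<and>
     sorted_wrt (\<lambda>u v. \<not> Z (fst u) (snd v)) l}"

lemma finite_nonvanishing_seqs: "finite W \<Longrightarrow> finite (nonvanishing_seqs W Z k C)"
  by (rule finite_subset[OF _ finite_lists_length_eq[of W k]]) (auto simp: nonvanishing_seqs_def)

lemma nonvanishing_seqs_Suc:
  "nonvanishing_seqs W Z (Suc k) C =
     (\<Union>v\<in>{v \<in> W. snd v \<in> C}. (#) v ` nonvanishing_seqs W Z k {y \<in> C. \<not> Z (fst v) y})"
proof (intro equalityI subsetI)
  fix l assume l: "l \<in> nonvanishing_seqs W Z (Suc k) C"
  then obtain v t where "l = v # t" by (cases l) (auto simp: nonvanishing_seqs_def)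
  with l show "l \<in> (\<Union>v\<in>{v \<in> W. snd v \<in> C}. (#) v ` nonvanishing_seqs W Z k {y \<in> C. \<not> Z (fst v) y})"
    by (intro UN_I[of v] image_eqI[of _ _ t]) (auto simp: nonvanishing_seqs_def)
qed (fastforce simp: nonvanishing_seqs_def)

text \<open>Each of the \<open>k\<close> steps costs a factor \<open>B\<close> if it is bad and \<open>card W\<close> if it is good; there are at
  most \<open>g\<close> good steps, which the weight \<open>\<theta>\<close> per good step keeps track of.\<close>
lemma card_nonvanishing_seqs_le:
  fixes \<theta> \<beta> B :: real
  assumes "finite W" "finite C" and \<theta>: "0 < \<theta>" "\<theta> \<le> 1" and \<beta>: "0 \<le> \<beta>" and B: "0 \<le> B"
    and bad: "\<And>C'. C' \<subseteq> C \<Longrightarrow>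
      real (card {v \<in> W. snd v \<in> C' \<and> \<beta> * real (card C') < real (card {y \<in> C'. \<not> Z (fst v) y})}) \<le> B"
    and g: "real (card C) * \<beta> ^ g < 1"
  shows "real (card (nonvanishing_seqs W Z k C)) \<le> (B + \<theta> * real (card W)) ^ k / \<theta> ^ g"
  using \<open>finite C\<close> bad g
proof (induction k arbitrary: C g)
  case 0
  have "nonvanishing_seqs W Z 0 C = {[]}" by (auto simp: nonvanishing_seqs_def)
  then show ?case using \<theta> by (simp add: power_le_one)
next
  case (Suc k)
  let ?w = "real (card W)"
  let ?M = "B + \<theta> * ?w"
  have M: "0 \<le> ?M" using B \<theta> by simp
  show ?case
  proof (cases "C = {}")
    case True
    then have "nonvanishing_seqs W Z (Suc k) C = {}" by (simp add: nonvanishing_seqs_Suc)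
    then show ?thesis using M \<theta> by simp
  next
    case False
    \<comment> \<open>A nonempty \<open>C\<close> violates the hypothesis for \<open>g = 0\<close>,
      so there is still a good step to spend.\<close>
    then have "1 \<le> real (card C)" using Suc.prems(1) by (simp add: Suc_le_eq card_gt_0_iff)
    then obtain g' where g': "g = Suc g'" using Suc.prems(3) by (cases g) auto
    let ?N = "\<lambda>v. {y \<in> C. \<not> Z (fst v) y}"
    let ?U = "{v \<in> W. snd v \<in> C}"
    let ?Bad = "{v \<in> W. snd v \<in> C \<and> \<beta> * real (card C) < real (card (?N v))}"
    have fin: "finite ?U" using assms(1) by simp
    have IH: "real (card (nonvanishing_seqs W Z k (?N v))) \<le> ?M ^ k / \<theta> ^ h"
      if "real (card (?N v)) * \<beta> ^ h < 1" for v h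
      using that Suc.prems(1) Suc.prems(2) by (intro Suc.IH) auto
    \<comment> \<open>After any step the allowed set only shrinks, so \<open>g\<close> still serves;
      after a good step it shrinks by the factor \<open>\<beta>\<close>, so \<open>g - 1\<close>
      serves.\<close>
    have any: "real (card (nonvanishing_seqs W Z k (?N v))) \<le> ?M ^ k / \<theta> ^ g" for v
    proof (rule IH)
      have "real (card (?N v)) * \<beta> ^ g \<le> real (card C) * \<beta> ^ g"
        using Suc.prems(1) \<beta> by (intro mult_right_mono) (auto intro: card_mono)
      then show "real (card (?N v)) * \<beta> ^ g < 1" using Suc.prems(3) by simp
    qed
    have good: "real (card (nonvanishing_seqs W Z k (?N v))) \<le> ?M ^ k / \<theta> ^ g'" if "v \<in> ?U - ?Bad" for v
    proof (rule IH)
      have "real (card (?N v)) * \<beta> ^ g' \<le> (\<beta> * real (card C)) * \<beta> ^ g'"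
        using that \<beta> by (intro mult_right_mono) auto
      then show "real (card (?N v)) * \<beta> ^ g' < 1" using Suc.prems(3) g' by (simp add: mult_ac)
    qed
    have "card (nonvanishing_seqs W Z (Suc k) C) \<le> (\<Sum>v\<in>?U. card (nonvanishing_seqs W Z k (?N v)))"
      unfolding nonvanishing_seqs_Suc
      by (rule order_trans[OF card_UN_le[OF fin]]) (intro sum_mono card_image_le finite_nonvanishing_seqs assms)
    then have "real (card (nonvanishing_seqs W Z (Suc k) C)) \<le> (\<Sum>v\<in>?U. real (card (nonvanishing_seqs W Z k (?N v))))"
      by (metis (no_types, lifting) of_nat_le_iff of_nat_sum sum.cong)
    also have "\<dots> = (\<Sum>v\<in>?Bad. real (card (nonvanishing_seqs W Z k (?N v)))) +
                    (\<Sum>v\<in>?U - ?Bad. real (card (nonvanishing_seqs W Z k (?N v))))"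
      using fin by (subst sum.subset_diff[of ?Bad ?U]) auto
    also have "\<dots> \<le> (\<Sum>v\<in>?Bad. ?M ^ k / \<theta> ^ g) + (\<Sum>v\<in>?U - ?Bad. ?M ^ k / \<theta> ^ g')"
      by (intro add_mono sum_mono any good) auto
    also have "\<dots> = real (card ?Bad) * (?M ^ k / \<theta> ^ g) + real (card (?U - ?Bad)) * (?M ^ k / \<theta> ^ g')"
      by simp
    also have "\<dots> \<le> B * (?M ^ k / \<theta> ^ g) + ?w * (?M ^ k / \<theta> ^ g')"
    proof (intro add_mono mult_right_mono)
      show "real (card ?Bad) \<le> B" using Suc.prems(2)[of C] by simp
      show "real (card (?U - ?Bad)) \<le> ?w" using assms(1) by (auto intro: card_mono)
    qed (use M \<theta> in auto)
    \<comment> \<open>Good steps carry \<open>\<theta> ^ g'\<close> in place of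
      \<open>\<theta> ^ g\<close>, hence one factor \<open>\<theta>\<close> beside
      \<open>?w\<close>, and the sum \<open>B + \<theta> * ?w\<close> is \<open>?M\<close>.\<close>
    also have "\<dots> = ?M ^ Suc k / \<theta> ^ g"
      using \<theta> by (simp add: g' field_simps)
    finally show ?thesis .
  qed
qed

text \<open>Union bound: there are at most \<open>n ^ k\<close> sets \<open>S\<close>, and each is
  spoiled by at most \<open>card ?F * ?w ^ (n - k)\<close> of the \<open>?w ^ n\<close>
  labellings.\<close>

lemma exists_labelling_with_vanishing_pairs:
  fixes Z :: "'x \<Rightarrow> 'y \<Rightarrow> bool"
  assumes W: "finite W" "snd ` W \<subseteq> C"
    and small: "real n ^ k * real (card (nonvanishing_seqs W Z k C)) < real (card W) ^ k"
  shows "\<exists>v. v ` {..<n} \<subseteq> W \<and>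
    (\<forall>S \<subseteq> {..<n}. card S = k \<longrightarrow> (\<exists>i\<in>S. \<exists>j\<in>S. i < j \<and> Z (fst (v i)) (snd (v j))))"
proof (cases "n < k")
  case True
  \<comment> \<open>There is no \<open>k\<close>-subset here, so any constant labelling works once
    \<open>W\<close> has an element; \<open>n < k\<close> gives \<open>0 < k\<close>, so an empty
    \<open>W\<close> would make the right side of \<open>small\<close> zero.\<close>
  have "W \<noteq> {}"
  proof
    assume "W = {}"
    then have "real (card W) ^ k = 0" using True by (simp add: zero_power)
    with small have "real n ^ k * real (card (nonvanishing_seqs W Z k C)) < 0" by simp
    then show False by (simp add: mult_less_0_iff)
  qed
  then obtain w where "w \<in> W" by auto
  moreover have "card S \<noteq> k" if "S \<subseteq> {..<n}" for S
    using card_mono[OF finite_lessThan that] True by simp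
  ultimately show ?thesis by (intro exI[of _ "\<lambda>_. w"]) auto
next
  case False
  let ?w = "card W"
  let ?F = "nonvanishing_seqs W Z k C"
  let ?V = "PiE {..<n} (\<lambda>_. W)"
  let ?K = "{S. S \<subseteq> {..<n} \<and> card S = k}"
  define bad where "bad S = {v \<in> ?V. \<forall>i\<in>S. \<forall>j\<in>S. i < j \<longrightarrow> \<not> Z (fst (v i)) (snd (v j))}" for S
  have bad_le: "card (bad S) \<le> card ?F * ?w ^ (n - k)" if S: "S \<in> ?K" for S
  proof -
    have finS: "finite S" using S finite_subset by auto
    \<comment> \<open>A labelling is encoded by its values on \<open>S\<close>, listed in increasing
      order of vertices, and its restriction to the other vertices. For a bad labelling the list
      lies in \<open>?F\<close>.\<close>
    let ?h = "\<lambda>v. (map v (sorted_list_of_set S), restrict v ({..<n} - S))"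
    have "inj_on ?h (bad S)"
    proof (rule inj_onI)
      fix u v assume uv: "u \<in> bad S" "v \<in> bad S" "?h u = ?h v"
      have "u i = v i" for i
      proof -
        consider "i \<in> S" | "i \<in> {..<n} - S" | "i \<notin> {..<n}" using S by auto
        then show ?thesis
        proof cases
          case 1
          then show ?thesis using uv(3) finS by simp
        next
          case 2
          have "restrict u ({..<n} - S) i = restrict v ({..<n} - S) i" using uv(3) by simp
          then show ?thesis using 2 by (simp only: restrict_apply if_True)
        next
          case 3
          moreover have "u \<in> ?V" "v \<in> ?V" using uv(1,2) by (auto simp only: bad_def mem_Collect_eq)
          ultimately show ?thesis by (metis PiE_arb)
        qed
      qed
      then show "u = v" by auto
    qed
    moreover have "?h ` bad S \<subseteq> ?F \<times> PiE ({..<n} - S) (\<lambda>_. W)"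
    proof (rule image_subsetI, intro SigmaI)
      fix v assume v: "v \<in> bad S"
      then have vW: "v i \<in> W" if "i \<in> S" for i using that S unfolding bad_def by auto
      have "sorted_wrt (\<lambda>u v. \<not> Z (fst u) (snd v)) (map v (sorted_list_of_set S))"
        unfolding sorted_wrt_map
        by (rule sorted_wrt_mono_rel[OF _ strict_sorted_list_of_set])
           (use v finS in \<open>auto simp: bad_def\<close>)
      then show "map v (sorted_list_of_set S) \<in> ?F"
        using S finS vW W(2) by (auto simp: nonvanishing_seqs_def)
      show "restrict v ({..<n} - S) \<in> PiE ({..<n} - S) (\<lambda>_. W)"
        using v by (auto simp: bad_def)
    qed
    moreover have "finite (?F \<times> PiE ({..<n} - S) (\<lambda>_. W))"
      using W by (intro finite_cartesian_product finite_nonvanishing_seqs finite_PiE) auto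
    ultimately have "card (bad S) \<le> card (?F \<times> PiE ({..<n} - S) (\<lambda>_. W))"
      by (rule card_inj_on_le)
    also have "\<dots> = card ?F * ?w ^ (n - k)"
      using S finS by (simp add: card_cartesian_product card_PiE card_Diff_subset)
    finally show ?thesis .
  qed
  have finK: "finite ?K" by simp
  have finV: "finite ?V" using W by (intro finite_PiE) auto
  have cK: "card ?K \<le> n ^ k"
    using n_subsets[of "{..<n}" k] binomial_le_pow[of k n] False by simp
  have "card (\<Union>S\<in>?K. bad S) \<le> (\<Sum>S\<in>?K. card (bad S))" by (rule card_UN_le[OF finK])
  also have "\<dots> \<le> (\<Sum>S\<in>?K. card ?F * ?w ^ (n - k))" by (intro sum_mono bad_le)
  also have "\<dots> = card ?K * (card ?F * ?w ^ (n - k))" by simp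
  also have "\<dots> \<le> n ^ k * (card ?F * ?w ^ (n - k))" by (rule mult_le_mono1[OF cK])
  also have "\<dots> < ?w ^ k * ?w ^ (n - k)"
  proof -
    have "real (n ^ k * card ?F) < real (?w ^ k)" using small by simp
    then have lt: "n ^ k * card ?F < ?w ^ k" by (simp only: of_nat_less_iff)
    moreover have "0 < ?w \<or> k = 0" using lt by (cases k) (auto intro: gr0I)
    \<comment> \<open>For \<open>k = 0\<close> the inequality \<open>lt\<close> would read
      \<open>1 < 1\<close>, so only \<open>0 < ?w\<close> remains.\<close>
    moreover have "nonvanishing_seqs W Z 0 C = {[]}" by (auto simp: nonvanishing_seqs_def)
    ultimately have "0 < ?w" by (cases "k = 0") auto
    then show ?thesis using lt by (simp add: mult.assoc[symmetric])
  qed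
  also have "\<dots> = card ?V" using False by (simp add: card_PiE flip: power_add)
  finally have "card (\<Union>S\<in>?K. bad S) < card ?V" .
  then have "\<not> ?V \<subseteq> (\<Union>S\<in>?K. bad S)"
    using card_mono[of "\<Union>S\<in>?K. bad S" ?V] finK finV by (auto simp: bad_def)
  then obtain v where "v \<in> ?V" "\<And>S. S \<in> ?K \<Longrightarrow> v \<notin> bad S" by blast
  then show ?thesis by (intro exI[of _ v]) (auto simp: bad_def)
qed

section \<open>Affine forms modulo a prime\<close>

text \<open>The space \<open>F_p^m\<close>, with least residues as representatives and extensional
  functions as vectors, so that vectors agreeing in all \<open>m\<close> coordinates are
  equal.\<close>

definition vecs :: "nat \<Rightarrow> nat \<Rightarrow> (nat \<Rightarrow> int) set" where
  "vecs p m = PiE {..<m} (\<lambda>_. {0..<int p})"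

text \<open>Affine rather than linear forms: distinct points are then never proportional, so that vanishing
  at one is independent of vanishing at the other.\<close>
definition form :: "nat \<Rightarrow> (nat \<Rightarrow> int) \<times> int \<Rightarrow> (nat \<Rightarrow> int) \<Rightarrow> int" where
  "form m x y = (\<Sum>j<m. fst x j * y j) + snd x"

definition vanishes :: "nat \<Rightarrow> nat \<Rightarrow> (nat \<Rightarrow> int) \<times> int \<Rightarrow> (nat \<Rightarrow> int) \<Rightarrow> bool" where
  "vanishes p m x y \<longleftrightarrow> int p dvd form m x y"

definition forms :: "nat \<Rightarrow> nat \<Rightarrow> ((nat \<Rightarrow> int) \<times> int) set" where
  "forms p m = vecs p m \<times> {0..<int p}"

definition nonzero_pairs :: "nat \<Rightarrow> nat \<Rightarrow> (((nat \<Rightarrow> int) \<times> int) \<times> (nat \<Rightarrow> int)) set" where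
  "nonzero_pairs p m = {(x, y) \<in> forms p m \<times> vecs p m. \<not> vanishes p m x y}"

lemma finite_vecs [simp]: "finite (vecs p m)"
  by (simp add: vecs_def finite_PiE)

lemma card_vecs [simp]: "card (vecs p m) = p ^ m"
  by (simp add: vecs_def card_PiE)

lemma finite_forms [simp]: "finite (forms p m)"
  by (simp add: forms_def)

lemma finite_nonzero_pairs [simp]: "finite (nonzero_pairs p m)"
  by (rule finite_subset[of _ "forms p m \<times> vecs p m"]) (auto simp: nonzero_pairs_def)

section \<open>Numbers of forms vanishing at given points\<close>

lemma residue_unique:
  fixes a b :: int
  assumes "int p dvd a - b" "a \<in> {0..<int p}" "b \<in> {0..<int p}"
  shows "a = b"
  using assms by (metis atLeastLessThan_iff mod_eq_dvd_iff mod_pos_pos_trivial)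

text \<open>The linear part is free and forces the constant term.\<close>

lemma card_vanishing_forms:
  assumes "0 < p"
  shows "card {x \<in> forms p m. vanishes p m x y} = p ^ m"
proof -
  let ?h = "\<lambda>a. (a, (- (\<Sum>j<m. a j * y j)) mod int p)"
  have "{x \<in> forms p m. vanishes p m x y} = ?h ` vecs p m"
  proof (intro equalityI subsetI)
    fix x assume x: "x \<in> {x \<in> forms p m. vanishes p m x y}"
    obtain a b where ab: "x = (a, b)" by (cases x)
    have "b = (- (\<Sum>j<m. a j * y j)) mod int p"
    proof (rule residue_unique)
      have "int p dvd (\<Sum>j<m. a j * y j) + b" using x ab by (simp add: vanishes_def form_def)
      moreover have "int p dvd (- (\<Sum>j<m. a j * y j)) - (- (\<Sum>j<m. a j * y j)) mod int p"
        by (rule dvd_minus_mod)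
      ultimately have "int p dvd ((\<Sum>j<m. a j * y j) + b) + ((- (\<Sum>j<m. a j * y j)) - (- (\<Sum>j<m. a j * y j)) mod int p)"
        by (rule dvd_add)
      then show "int p dvd b - (- (\<Sum>j<m. a j * y j)) mod int p" by simp
    qed (use x ab assms in \<open>auto simp: forms_def\<close>)
    then show "x \<in> ?h ` vecs p m" using x ab by (auto simp: forms_def)
  next
    fix x assume "x \<in> ?h ` vecs p m"
    then show "x \<in> {x \<in> forms p m. vanishes p m x y}"
      using assms by (auto simp: forms_def vanishes_def form_def dvd_eq_mod_eq_0 mod_add_right_eq)
  qed
  moreover have "inj_on ?h (vecs p m)" by (auto simp: inj_on_def)
  ultimately show ?thesis by (simp add: card_image)
qed

text \<open>Let \<open>y\<close> and \<open>y'\<close> differ in coordinate \<open>i\<close>. Once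
  the other linear coefficients are fixed, the difference of the two values determines coefficient
  \<open>i\<close>, and then either value determines the constant term.\<close>

lemma card_vanishing_forms_pair_le:
  assumes "prime p" and y: "y \<in> vecs p m" "y' \<in> vecs p m" "y \<noteq> y'"
  shows "card {x \<in> forms p m. vanishes p m x y \<and> vanishes p m x y'} \<le> p ^ (m - 1)"
proof -
  obtain i where i: "i < m" "y i \<noteq> y' i"
    using y unfolding vecs_def by (metis PiE_ext lessThan_iff)
  let ?A = "{x \<in> forms p m. vanishes p m x y \<and> vanishes p m x y'}"
  let ?I = "{..<m} - {i}"
  let ?h = "\<lambda>x. restrict (fst x) ?I"
  have "inj_on ?h ?A"
  proof (rule inj_onI)
    fix u v assume u: "u \<in> ?A" and v: "v \<in> ?A" and uv: "?h u = ?h v"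
    have uv_mem: "fst u \<in> PiE {..<m} (\<lambda>_. {0..<int p})" "fst v \<in> PiE {..<m} (\<lambda>_. {0..<int p})"
      using u v unfolding forms_def vecs_def mem_Collect_eq mem_Times_iff by blast+
    have eq: "fst u j = fst v j" if "j < m" "j \<noteq> i" for j
      using fun_cong[OF uv, of j] that by simp
    have "int p dvd (form m u y - form m u y') - (form m v y - form m v y')"
      using u v by (auto simp: vanishes_def intro!: dvd_diff)
    also have "(form m u y - form m u y') - (form m v y - form m v y') =
        (\<Sum>j<m. (fst u j - fst v j) * (y j - y' j))"
      by (simp add: form_def algebra_simps sum.distrib sum_subtractf)
    also have "\<dots> = (fst u i - fst v i) * (y i - y' i)"
      using i eq by (subst sum.remove[of _ i]) (auto intro!: sum.neutral)
    finally have "int p dvd (fst u i - fst v i) * (y i - y' i)" .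
    moreover have "\<not> int p dvd y i - y' i"
      using i y residue_unique[of p "y i" "y' i"] by (auto simp: vecs_def PiE_iff)
    ultimately have "int p dvd fst u i - fst v i"
      using assms(1) by (simp add: prime_dvd_mult_iff)
    then have ui: "fst u i = fst v i"
      by (rule residue_unique) (use PiE_mem[OF uv_mem(1), of i] PiE_mem[OF uv_mem(2), of i] i in simp_all)
    have "fst u = fst v"
    proof
      fix j
      show "fst u j = fst v j"
        using ui eq[of j] PiE_arb[OF uv_mem(1), of j] PiE_arb[OF uv_mem(2), of j]
        by (cases "j < m"; cases "j = i") simp_all
    qed
    moreover have "int p dvd form m u y - form m v y"
      using u v by (auto simp: vanishes_def intro!: dvd_diff)
    ultimately have "int p dvd snd u - snd v" by (simp add: form_def)
    then have "snd u = snd v"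
      using u v residue_unique[of p "snd u" "snd v"] by (auto simp: forms_def)
    with \<open>fst u = fst v\<close> show "u = v" by (simp add: prod_eq_iff)
  qed
  moreover have "?h ` ?A \<subseteq> PiE ?I (\<lambda>_. {0..<int p})"
  proof (rule image_subsetI)
    fix x assume "x \<in> ?A"
    then have "fst x \<in> PiE {..<m} (\<lambda>_. {0..<int p})"
      unfolding forms_def vecs_def mem_Collect_eq mem_Times_iff by blast
    then show "?h x \<in> PiE ?I (\<lambda>_. {0..<int p})"
      unfolding restrict_PiE_iff by (blast dest: PiE_mem)
  qed
  moreover have "finite (PiE ?I (\<lambda>_. {0..<int p}))" by (intro finite_PiE) auto
  ultimately have "card ?A \<le> card (PiE ?I (\<lambda>_. {0..<int p}))" by (rule card_inj_on_le)
  also have "\<dots> = p ^ (m - 1)" using i by (simp add: card_PiE)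
  finally show ?thesis .
qed

lemma card_nonzero_pairs:
  assumes "0 < p"
  shows "real (card (nonzero_pairs p m)) = real p ^ (2 * m) * (real p - 1)"
proof -
  let ?z = "Sigma (vecs p m) (\<lambda>y. {x \<in> forms p m. vanishes p m x y})"
  let ?all = "vecs p m \<times> forms p m"
  have "nonzero_pairs p m = prod.swap ` (?all - ?z)"
    by (force simp: nonzero_pairs_def image_iff)
  then have "card (nonzero_pairs p m) = card (?all - ?z)"
    by (simp only: card_image inj_swap)
  also have "real \<dots> = real (card ?all) - real (card ?z)"
  proof -
    have "?z \<subseteq> ?all" by auto
    then have "card (?all - ?z) = card ?all - card ?z" "card ?z \<le> card ?all"
      by (auto intro!: card_Diff_subset card_mono simp del: card_SigmaI card_cartesian_product)
    then show ?thesis by (simp only: of_nat_diff)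
  qed
  also have "card ?z = p ^ m * p ^ m"
    using assms by (subst card_SigmaI) (simp_all add: card_vanishing_forms)
  also have "card ?all = p ^ m * (p ^ m * p)"
    by (simp add: forms_def card_cartesian_product)
  finally show ?thesis by (simp add: algebra_simps mult_2_right power_add)
qed

text \<open>Second moment of the number of zeros in \<open>C\<close>: a pair of distinct points
  contributes at most \<open>p ^ (m - 1)\<close> forms, a pair of equal points
  \<open>p ^ m\<close>.\<close>

lemma sum_square_deviation_le:
  assumes "prime p" "0 < m" and C: "C \<subseteq> vecs p m"
  shows "(\<Sum>x\<in>forms p m. (real p * real (card {y \<in> C. vanishes p m x y}) - real (card C))\<^sup>2)
    \<le> real p ^ (m + 2) * real (card C)"
proof -
  let ?X = "forms p m"
  let ?c = "real (card C)"
  let ?i = "\<lambda>x y. if vanishes p m x y then 1 else 0 :: real"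
  let ?N = "\<lambda>x. \<Sum>y\<in>C. ?i x y"
  have p: "0 < p" using assms(1) by (simp add: prime_gt_0_nat)
  have finC: "finite C" by (rule finite_subset[OF C finite_vecs])
  have N: "real (card {y \<in> C. vanishes p m x y}) = ?N x" for x
    using finC by (simp add: sum.If_cases Int_def)
  have S1: "(\<Sum>x\<in>?X. ?i x y) = real p ^ m" for y
    using card_vanishing_forms[OF p, of m y] by (simp add: sum.If_cases Int_def)
  have S2: "(\<Sum>x\<in>?X. ?i x y * ?i x y') \<le> real p ^ (m - 1) + (if y = y' then real p ^ m else 0)"
    if "y \<in> C" "y' \<in> C" for y y'
  proof (cases "y = y'")
    case True
    have "(\<Sum>x\<in>?X. ?i x y * ?i x y') = (\<Sum>x\<in>?X. ?i x y)"
      using True by (intro sum.cong) auto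
    then show ?thesis using True S1[of y] by simp
  next
    case False
    have "(\<Sum>x\<in>?X. ?i x y * ?i x y') = (\<Sum>x\<in>?X. if vanishes p m x y \<and> vanishes p m x y' then 1 else 0)"
      by (intro sum.cong) auto
    also have "\<dots> = real (card {x \<in> ?X. vanishes p m x y \<and> vanishes p m x y'})"
      by (simp add: sum.If_cases Int_def)
    also have "\<dots> \<le> real (p ^ (m - 1))"
      using that C False assms(1)
      by (intro of_nat_mono card_vanishing_forms_pair_le) auto
    finally show ?thesis using False by simp
  qed
  have sumN: "(\<Sum>x\<in>?X. ?N x) = ?c * real p ^ m"
    by (subst sum.swap) (simp add: S1)
  have "(\<Sum>x\<in>?X. (?N x)\<^sup>2) = (\<Sum>x\<in>?X. \<Sum>y\<in>C. \<Sum>y'\<in>C. ?i x y * ?i x y')"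
    by (simp only: power2_eq_square sum_product)
  also have "\<dots> = (\<Sum>y\<in>C. \<Sum>x\<in>?X. \<Sum>y'\<in>C. ?i x y * ?i x y')"
    by (rule sum.swap)
  also have "\<dots> = (\<Sum>y\<in>C. \<Sum>y'\<in>C. \<Sum>x\<in>?X. ?i x y * ?i x y')"
    by (intro sum.cong refl sum.swap)
  also have "\<dots> \<le> (\<Sum>y\<in>C. \<Sum>y'\<in>C. real p ^ (m - 1) + (if y = y' then real p ^ m else 0))"
    by (intro sum_mono S2)
  also have "\<dots> = ?c\<^sup>2 * real p ^ (m - 1) + ?c * real p ^ m"
    using finC by (simp add: sum.distrib power2_eq_square algebra_simps)
  finally have sumN2: "(\<Sum>x\<in>?X. (?N x)\<^sup>2) \<le> ?c\<^sup>2 * real p ^ (m - 1) + ?c * real p ^ m" .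
  have cX: "real (card ?X) = real p ^ (m + 1)"
    by (simp add: forms_def card_cartesian_product)
  obtain m' where m': "m = Suc m'" using assms(2) by (cases m) auto
  have "(\<Sum>x\<in>?X. (real p * ?N x - ?c)\<^sup>2) =
     (\<Sum>x\<in>?X. (real p)\<^sup>2 * (?N x)\<^sup>2 - 2 * real p * ?c * ?N x + ?c\<^sup>2)"
    by (intro sum.cong refl) (simp add: power2_diff power_mult_distrib)
  also have "\<dots> = (real p)\<^sup>2 * (\<Sum>x\<in>?X. (?N x)\<^sup>2) - 2 * real p * ?c * (\<Sum>x\<in>?X. ?N x)
      + real (card ?X) * ?c\<^sup>2"
    by (simp only: sum.distrib sum_subtractf sum_distrib_left sum_constant)
  also have "\<dots> \<le> (real p)\<^sup>2 * (?c\<^sup>2 * real p ^ (m - 1) + ?c * real p ^ m)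
      - 2 * real p * ?c * (?c * real p ^ m) + real p ^ (m + 1) * ?c\<^sup>2"
    unfolding sumN cX by (intro add_mono diff_mono mult_left_mono sumN2) auto
  \<comment> \<open>The terms in \<open>?c\<^sup>2\<close> have coefficients 1, -2 and 1 times
    \<open>p ^ (m + 1)\<close> and cancel; the diagonal term remains.\<close>
  also have "\<dots> = real p ^ (m + 2) * ?c"
    by (simp add: m' power2_eq_square algebra_simps)
  finally show ?thesis unfolding N .
qed

text \<open>The form of a bad pair vanishes at fewer than half of the \<open>card C / p\<close>
  points expected, so \<open>p\<close> times its count deviates from \<open>card C\<close> by at
  least \<open>card C / 2\<close>. Chebyshev bounds the set \<open>D\<close> of such forms by
  \<open>4 * p ^ (m + 2) / card C\<close>, and the bad pairs lie in \<open>D \<times> C\<close>, so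
  \<open>card C\<close> cancels.\<close>

lemma card_bad_pairs_le:
  assumes "prime p" "0 < m" and C: "C \<subseteq> vecs p m"
  shows "real (card {v \<in> nonzero_pairs p m. snd v \<in> C \<and>
      (1 - 1 / (2 * real p)) * real (card C) < real (card {y \<in> C. \<not> vanishes p m (fst v) y})})
    \<le> 4 * real p ^ (m + 2)"
proof -
  let ?c = "real (card C)"
  let ?N = "\<lambda>x. real (card {y \<in> C. vanishes p m x y})"
  define D where "D = {x \<in> forms p m. ?N x < ?c / (2 * real p)}"
  let ?B = "{v \<in> nonzero_pairs p m. snd v \<in> C \<and>
      (1 - 1 / (2 * real p)) * ?c < real (card {y \<in> C. \<not> vanishes p m (fst v) y})}"
  have p: "0 < p" using assms(1) by (simp add: prime_gt_0_nat)
  have finC: "finite C" by (rule finite_subset[OF C finite_vecs])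
  have finD: "finite D" by (simp add: D_def)
  have split: "?N x + real (card {y \<in> C. \<not> vanishes p m x y}) = ?c" for x
  proof -
    have "card ({y \<in> C. vanishes p m x y} \<union> {y \<in> C. \<not> vanishes p m x y}) =
        card {y \<in> C. vanishes p m x y} + card {y \<in> C. \<not> vanishes p m x y}"
      using finC by (intro card_Un_disjoint) auto
    moreover have "{y \<in> C. vanishes p m x y} \<union> {y \<in> C. \<not> vanishes p m x y} = C" by auto
    ultimately have "card C = card {y \<in> C. vanishes p m x y} + card {y \<in> C. \<not> vanishes p m x y}"
      by simp
    then show ?thesis by simp
  qed
  have "?B \<subseteq> D \<times> C"
  proof
    fix v assume v: "v \<in> ?B"
    have "?N (fst v) < ?c / (2 * real p)"
      using v split[of "fst v"] by (simp add: left_diff_distrib)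
    then show "v \<in> D \<times> C" using v by (cases v) (auto simp: D_def nonzero_pairs_def)
  qed
  then have "card ?B \<le> card (D \<times> C)"
    using finD finC by (intro card_mono) auto
  then have B: "real (card ?B) \<le> real (card D) * ?c"
    by (simp only: card_cartesian_product of_nat_le_iff of_nat_mult[symmetric])
  have "real (card D) * (?c\<^sup>2 / 4) = (\<Sum>x\<in>D. (?c / 2)\<^sup>2)"
    by (simp add: power_divide)
  also have "\<dots> \<le> (\<Sum>x\<in>D. (real p * ?N x - ?c)\<^sup>2)"
  proof (intro sum_mono)
    fix x assume "x \<in> D"
    then have "real p * ?N x \<le> ?c / 2" using p by (simp add: D_def field_simps)
    then have "(?c / 2)\<^sup>2 \<le> (?c - real p * ?N x)\<^sup>2" by (intro power_mono) auto
    then show "(?c / 2)\<^sup>2 \<le> (real p * ?N x - ?c)\<^sup>2" by (metis power2_commute)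
  qed
  also have "\<dots> \<le> (\<Sum>x\<in>forms p m. (real p * ?N x - ?c)\<^sup>2)"
    by (intro sum_mono2) (auto simp: D_def)
  also have "\<dots> \<le> real p ^ (m + 2) * ?c" by (rule sum_square_deviation_le[OF assms])
  finally have *: "(real (card D) * ?c) * ?c \<le> (4 * real p ^ (m + 2)) * ?c"
    by (simp add: power2_eq_square algebra_simps)
  show ?thesis
  proof (cases "card C = 0")
    case True
    then have "real (card ?B) \<le> 0" using B by (simp only: of_nat_0 mult_zero_right)
    then show ?thesis by (rule order_trans) simp
  next
    case False
    then have "real (card D) * ?c \<le> 4 * real p ^ (m + 2)" using * by simp
    with B show ?thesis by simp
  qed
qed

text \<open>A clique gives a triangular matrix of values with nonzero diagonal, so its forms are linearly
  independent modulo \<open>p\<close>; independence is expressed by counting linear combinations.\<close>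
lemma triangular_family_card_le:
  fixes S :: "nat set"
  assumes "prime p" "finite S"
    and diag: "\<And>i. i \<in> S \<Longrightarrow> \<not> vanishes p m (x i) (y i)"
    and upper: "\<And>i j. i \<in> S \<Longrightarrow> j \<in> S \<Longrightarrow> i < j \<Longrightarrow> vanishes p m (x i) (y j)"
  shows "card S \<le> m + 1"
proof -
  let ?A = "PiE S (\<lambda>_. {0..<int p})"
  let ?h = "\<lambda>c. ((\<lambda>l\<in>{..<m}. (\<Sum>i\<in>S. c i * fst (x i) l) mod int p), (\<Sum>i\<in>S. c i * snd (x i)) mod int p)"
  have p: "1 < p" using assms(1) by (rule prime_gt_1_nat)
  have "inj_on ?h ?A"
  proof (rule inj_onI, rule ccontr)
    fix c d assume c: "c \<in> ?A" and d: "d \<in> ?A" and cd: "?h c = ?h d" and ne: "c \<noteq> d"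
    define T where "T = {i \<in> S. c i \<noteq> d i}"
    have "T \<noteq> {}"
    proof
      assume "T = {}"
      then have "c i = d i" if "i \<in> S" for i using that by (auto simp: T_def)
      with PiE_ext[OF c d] ne show False by blast
    qed
    moreover have "finite T" using assms(2) by (simp add: T_def)
    ultimately have j: "Max T \<in> T" and maxT: "\<And>i. i \<in> T \<Longrightarrow> i \<le> Max T" by auto
    \<comment> \<open>The vanishing combination is evaluated at \<open>y j\<close> for the largest
      index \<open>j\<close> at which \<open>c\<close> and \<open>d\<close> differ: terms with
      \<open>i < j\<close> vanish by \<open>upper\<close>, those with \<open>i > j\<close> have
      coefficient zero, and the diagonal term is left alone.\<close>
    define j where "j = Max T"
    have jS: "j \<in> S" and cdj: "c j \<noteq> d j" using j by (auto simp: T_def j_def)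
    have l: "int p dvd (\<Sum>i\<in>S. (c i - d i) * fst (x i) l)" if "l < m" for l
    proof -
      have "(\<Sum>i\<in>S. c i * fst (x i) l) mod int p = (\<Sum>i\<in>S. d i * fst (x i) l) mod int p"
        using fun_cong[OF arg_cong[OF cd, of fst], of l] that by simp
      then show ?thesis by (simp add: mod_eq_dvd_iff left_diff_distrib sum_subtractf)
    qed
    have b: "int p dvd (\<Sum>i\<in>S. (c i - d i) * snd (x i))"
      using arg_cong[OF cd, of snd] by (simp add: mod_eq_dvd_iff left_diff_distrib sum_subtractf)
    have "(\<Sum>i\<in>S. (c i - d i) * form m (x i) (y j)) =
       (\<Sum>i\<in>S. \<Sum>l<m. (c i - d i) * fst (x i) l * y j l) + (\<Sum>i\<in>S. (c i - d i) * snd (x i))"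
      by (simp add: form_def distrib_left sum.distrib sum_distrib_left mult.assoc)
    also have "(\<Sum>i\<in>S. \<Sum>l<m. (c i - d i) * fst (x i) l * y j l) =
       (\<Sum>l<m. \<Sum>i\<in>S. (c i - d i) * fst (x i) l * y j l)" by (rule sum.swap)
    also have "\<dots> = (\<Sum>l<m. (\<Sum>i\<in>S. (c i - d i) * fst (x i) l) * y j l)"
      by (simp only: sum_distrib_right)
    finally have "int p dvd (\<Sum>i\<in>S. (c i - d i) * form m (x i) (y j))"
      using l b by (auto intro!: dvd_add dvd_sum)
    moreover have "(\<Sum>i\<in>S. (c i - d i) * form m (x i) (y j)) =
       (c j - d j) * form m (x j) (y j) + (\<Sum>i\<in>S - {j}. (c i - d i) * form m (x i) (y j))"
      using assms(2) jS by (rule sum.remove)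
    moreover have "int p dvd (\<Sum>i\<in>S - {j}. (c i - d i) * form m (x i) (y j))"
    proof (rule dvd_sum)
      fix i assume i: "i \<in> S - {j}"
      show "int p dvd (c i - d i) * form m (x i) (y j)"
      proof (cases "i < j")
        case True
        then show ?thesis using upper[of i j] i jS by (simp add: vanishes_def)
      next
        case False
        then have "i \<notin> T" using maxT[of i] i unfolding j_def by force
        then show ?thesis using i by (simp add: T_def)
      qed
    qed
    ultimately have "int p dvd (c j - d j) * form m (x j) (y j)"
      by (simp add: dvd_add_left_iff)
    then have "int p dvd c j - d j"
      using diag[OF jS] assms(1) by (simp add: prime_dvd_mult_iff vanishes_def)
    then have "c j = d j" using c d jS by (intro residue_unique) (auto simp: PiE_iff)
    with cdj show False ..
  qed
  moreover have "?h ` ?A \<subseteq> forms p m"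
    using p by (intro image_subsetI) (simp add: forms_def vecs_def restrict_PiE_iff)
  ultimately have "card ?A \<le> card (forms p m)" by (intro card_inj_on_le) auto
  then have "p ^ card S \<le> p ^ (m + 1)"
    using assms(2) by (simp add: card_PiE forms_def card_cartesian_product mult.commute)
  then show ?thesis using p power_le_imp_le_exp by blast
qed

section \<open>The Ramsey graph\<close>

text \<open>\<open>R\<close> is the ratio of the number of all pairs to the bound \<open>B\<close>
  on bad pairs. With the weight \<open>\<theta> = 1 / R\<close> bad and good steps contribute
  equally, \<open>B + \<theta> * card W = 2 * B\<close>, and the count of lists is at most
  \<open>(2 * B) ^ k * R ^ g\<close>.\<close>

lemma not_ramsey_property:
  fixes p m k n g :: nat
  defines "R \<equiv> real p ^ (m - 2) * (real p - 1) / 4"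
  assumes "prime p" "2 \<le> m" "1 \<le> R"
    and g: "real p ^ m * (1 - 1 / (2 * real p)) ^ g < 1"
    and n: "(2 * real n) ^ k * R ^ g < R ^ k"
  shows "\<not> ramsey_property (m + 2) k n"
proof -
  let ?W = "nonzero_pairs p m"
  let ?Z = "vanishes p m"
  let ?F = "nonvanishing_seqs ?W ?Z k (vecs p m)"
  define B where "B = 4 * real p ^ (m + 2)"
  have p: "1 < p" using assms(2) by (rule prime_gt_1_nat)
  have B: "0 < B" using p by (simp add: B_def)
  have w: "real (card ?W) = R * B"
  proof -
    obtain m' where m': "m = m' + 2" using assms(3) by (metis add.commute le_Suc_ex)
    have "real p ^ (2 * m) = real p ^ (m - 2) * real p ^ (m + 2)"
      by (simp add: m' mult_2 flip: power_add)
    then show ?thesis using p by (simp add: card_nonzero_pairs R_def B_def)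
  qed
  have "real (card ?F) \<le> (B + (1 / R) * real (card ?W)) ^ k / (1 / R) ^ g"
  proof (rule card_nonvanishing_seqs_le)
    show "0 \<le> 1 - 1 / (2 * real p)" using p by simp
    show "real (card (vecs p m)) * (1 - 1 / (2 * real p)) ^ g < 1" using g by simp
    show "real (card {v \<in> ?W. snd v \<in> C' \<and> (1 - 1 / (2 * real p)) * real (card C') <
        real (card {y \<in> C'. \<not> ?Z (fst v) y})}) \<le> B" if "C' \<subseteq> vecs p m" for C'
      unfolding B_def using assms(2,3) that by (intro card_bad_pairs_le) auto
  qed (use assms(4) B in auto)
  also have "\<dots> = (2 * B) ^ k * R ^ g"
    using assms(4) by (simp add: w power_one_over field_simps)
  finally have F: "real (card ?F) \<le> (2 * B) ^ k * R ^ g" .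
  have "real n ^ k * real (card ?F) \<le> real n ^ k * ((2 * B) ^ k * R ^ g)"
    using F by (rule mult_left_mono) simp
  also have "\<dots> = ((2 * real n) ^ k * R ^ g) * B ^ k"
    by (simp add: power_mult_distrib)
  also have "\<dots> < R ^ k * B ^ k"
    using n B by (intro mult_strict_right_mono) auto
  also have "\<dots> = real (card ?W) ^ k" by (simp add: w power_mult_distrib)
  finally have "\<exists>v. v ` {..<n} \<subseteq> ?W \<and>
    (\<forall>S \<subseteq> {..<n}. card S = k \<longrightarrow> (\<exists>i\<in>S. \<exists>j\<in>S. i < j \<and> ?Z (fst (v i)) (snd (v j))))"
    by (intro exists_labelling_with_vanishing_pairs[where C = "vecs p m"] finite_nonzero_pairs)
       (auto simp: nonzero_pairs_def)
  then obtain v where vW: "v ` {..<n} \<subseteq> ?W"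
    and v: "\<And>S. S \<subseteq> {..<n} \<Longrightarrow> card S = k \<Longrightarrow> \<exists>i\<in>S. \<exists>j\<in>S. i < j \<and> ?Z (fst (v i)) (snd (v j))"
    by blast
  \<comment> \<open>\<open>min\<close> and \<open>max\<close> make the relation symmetric: the form
    of the earlier vertex is evaluated at the point of the later one.\<close>
  define E where "E i j \<longleftrightarrow> i \<noteq> j \<and> ?Z (fst (v (min i j))) (snd (v (max i j)))" for i j :: nat
  have "simple_graph {..<n} E"
    by (auto simp: simple_graph_def E_def min.commute max.commute)
  moreover have "\<not> is_clique E S" if "S \<subseteq> {..<n}" "card S = m + 2" for S
  proof
    assume cl: "is_clique E S"
    have "finite S" using that(1) by (rule finite_subset) simp
    then have "card S \<le> m + 1"
    proof (rule triangular_family_card_le[OF assms(2), where x = "\<lambda>i. fst (v i)" and y = "\<lambda>i. snd (v i)"])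
      fix i assume "i \<in> S"
      then have "v i \<in> ?W" using that(1) vW by auto
      then show "\<not> ?Z (fst (v i)) (snd (v i))" by (auto simp: nonzero_pairs_def)
    next
      fix i j assume "i \<in> S" "j \<in> S" "i < j"
      then have "E i j" using cl by (auto simp: is_clique_def)
      then show "?Z (fst (v i)) (snd (v j))" using \<open>i < j\<close> by (simp add: E_def)
    qed
    with that(2) show False by simp
  qed
  moreover have "\<not> is_indep E S" if "S \<subseteq> {..<n}" "card S = k" for S
  proof
    assume "is_indep E S"
    moreover from v[OF that] obtain i j
      where "i \<in> S" "j \<in> S" "i < j" "?Z (fst (v i)) (snd (v j))"
      by blast
    moreover from this have "E i j" by (simp add: E_def)
    ultimately show False by (auto simp: is_indep_def)
  qed
  ultimately show ?thesis unfolding ramsey_property_def by blast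
qed

text \<open>By the finite Ramsey theorem some \<open>n\<close> has the property, so
  \<open>LEAST\<close> is attained. The work lies in passing from the edge relation to a set of
  two-element sets.\<close>

lemma ramsey_property_ramsey_number: "ramsey_property s k (ramsey_number s k)"
proof -
  obtain r where r: "\<forall>(V :: nat set) E. finite V \<and> card V \<ge> r \<longrightarrow>
      (\<exists>R \<subseteq> V. card R = s \<and> clique R E \<or> card R = k \<and> indep R E)"
    using ramsey2[where 'a = nat, of s k] by blast
  have "ramsey_property s k r"
    unfolding ramsey_property_def
  proof (intro allI impI)
    fix G :: "nat \<Rightarrow> nat \<Rightarrow> bool" assume G: "simple_graph {..<r} G"
    let ?E = "{{x, y} | x y. x < r \<and> y < r \<and> G x y}"
    have edge: "{x, y} \<in> ?E \<longleftrightarrow> G x y" if "x < r" "y < r" for x y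
      using G that by (auto simp: simple_graph_def doubleton_eq_iff)
    obtain R where R: "R \<subseteq> {..<r}" "card R = s \<and> clique R ?E \<or> card R = k \<and> indep R ?E"
      using r[rule_format, of "{..<r}" ?E] by auto
    have "clique R ?E \<longleftrightarrow> is_clique G R" "indep R ?E \<longleftrightarrow> is_indep G R"
      using R(1) edge unfolding clique_def indep_def is_clique_def is_indep_def
      by (metis (no_types, lifting) lessThan_iff subsetD)+
    then show "(\<exists>S\<subseteq>{..<r}. card S = s \<and> is_clique G S) \<or> (\<exists>S\<subseteq>{..<r}. card S = k \<and> is_indep G S)"
      using R by blast
  qed
  then show ?thesis unfolding ramsey_number_def by (rule LeastI)
qed

section \<open>Choice of the parameters\<close>

theorem theorem1p3:
  fixes \<delta> :: real
  assumes "\<delta> > 0"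
  shows "\<exists>L::real. \<forall>s k :: nat. 0 < s \<and> 0 < k \<and> real s \<ge> L \<and> real k \<ge> L * real s \<longrightarrow>
           real (ramsey_number s k) \<ge> (real k / real s) powr ((1 - \<delta>) * real s)"
proof -
  \<comment> \<open>A smaller \<open>d\<close> gives a stronger bound, and
    \<open>d \<le> 1 / 2\<close> keeps all exponents positive.\<close>
  define d where "d = min \<delta> (1 / 2)"
  have d: "0 < d" "d \<le> 1 / 2" "d \<le> \<delta>" using assms by (auto simp: d_def)
  \<comment> \<open>Chosen so that a prime in the interval below \<open>T powr (1 - d / 4)\<close>
    is at least \<open>T powr (1 - d / 2)\<close>.\<close>
  define e where "e = 1 - (1 - d / 2) / (1 - d / 4)"
  have e: "0 < e" "(1 - d / 4) * (1 - e) = 1 - d / 2"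
    using d by (auto simp: e_def field_simps)
  have "\<forall>\<^sub>F T :: real in at_top. \<exists>p :: nat. prime p \<and>
      (T powr (1 - d / 4)) powr (1 - e) \<le> real p \<and> real p \<le> T powr (1 - d / 4)"
  proof (rule eventually_compose_filterlim[OF eventually_prime_in_powr_interval[OF e(1)]])
    show "filterlim (\<lambda>T :: real. T powr (1 - d / 4)) at_top at_top"
      using d by real_asymp
  qed
  \<comment> \<open>Multiplied by \<open>s\<close>, this bounds the number \<open>g\<close> of good
    steps by \<open>(d / 8) * k\<close>. It is why \<open>p\<close> must stay below \<open>T\<close>
    by a power of \<open>T\<close>.\<close>
  moreover have "\<forall>\<^sub>F T :: real in at_top. 2 * T powr (1 - d / 4) * ln T + 2 \<le> (d / 8) * T"
    using d by real_asymp
  moreover have "\<forall>\<^sub>F T :: real in at_top. 8 \<le> T powr (1 - d / 2)"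
  proof -
    have "filterlim (\<lambda>T :: real. T powr (1 - d / 2)) at_top at_top" using d by real_asymp
    then show ?thesis by (simp add: filterlim_at_top)
  qed
  moreover have "\<forall>\<^sub>F T :: real in at_top. 16 \<le> T" by (rule eventually_ge_at_top)
  ultimately have "\<forall>\<^sub>F T :: real in at_top.
      (\<exists>p :: nat. prime p \<and> T powr (1 - d / 2) \<le> real p \<and> real p \<le> T powr (1 - d / 4)) \<and>
      2 * T powr (1 - d / 4) * ln T + 2 \<le> (d / 8) * T \<and> 8 \<le> T powr (1 - d / 2) \<and> 16 \<le> T"
    by eventually_elim (simp add: powr_powr e(2))
  then obtain L where L: "\<And>T. L \<le> T \<Longrightarrow>
      (\<exists>p :: nat. prime p \<and> T powr (1 - d / 2) \<le> real p \<and> real p \<le> T powr (1 - d / 4)) \<and>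
      2 * T powr (1 - d / 4) * ln T + 2 \<le> (d / 8) * T \<and> 8 \<le> T powr (1 - d / 2) \<and> 16 \<le> T"
    unfolding eventually_at_top_linorder by blast
  show ?thesis
  \<comment> \<open>One constant serves twice: \<open>L\<close> makes \<open>T = k / s\<close> large
    enough, and \<open>12 / d \<le> s\<close> lets \<open>d * s\<close> absorb the losses in the
    exponent.\<close>
  proof (intro exI[of _ "max L (12 / d)"] allI impI)
    fix s k :: nat
    assume sk: "0 < s \<and> 0 < k \<and> max L (12 / d) \<le> real s \<and> max L (12 / d) * real s \<le> real k"
    define T where "T = real k / real s"
    define r where "r = ramsey_number s k"
    have s: "12 / d \<le> real s" "0 < s" using sk by auto
    have k: "real k = T * real s" using sk by (simp add: T_def)
    have "max L (12 / d) \<le> T" unfolding T_def using sk by (subst pos_le_divide_eq) auto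
    then have "L \<le> T" by simp
    from L[OF this] obtain p where p: "prime p" "T powr (1 - d / 2) \<le> real p" "real p \<le> T powr (1 - d / 4)"
      and T1: "2 * T powr (1 - d / 4) * ln T + 2 \<le> (d / 8) * T"
      and T2: "8 \<le> T powr (1 - d / 2)" and T3: "16 \<le> T" by blast
    have ds: "12 \<le> d * real s" using s(1) d(1) by (simp add: field_simps)
    have "d * real s \<le> 1 / 2 * real s" using d(2) by (intro mult_right_mono) auto
    then have s24: "24 \<le> s" using ds by simp
    define m where "m = s - 2"
    have m: "s = m + 2" "2 \<le> m" using s24 by (auto simp: m_def)
    have p8: "8 \<le> real p" using p(2) T2 by simp
    have "T powr (1 - d / 4) \<le> T powr 1" using T3 d by (intro powr_mono) auto
    then have pT: "real p \<le> T" using p(3) T3 by simp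

    \<comment> \<open>As \<open>(1 - 1 / (2 * p)) ^ g\<close> is at most
      \<open>exp (- g / (2 * p))\<close>, more than \<open>2 * p * m * ln p\<close> good steps empty
      the space of \<open>p ^ m\<close> points. The code uses \<open>s\<close> for \<open>m\<close>,
      and the added 1 gives strictness.\<close>
    define g where "g = nat \<lceil>2 * real p * real s * ln (real p)\<rceil> + 1"
    have lnp: "0 \<le> ln (real p)" using p8 by simp
    have nn: "0 \<le> 2 * real p * real s * ln (real p)" using lnp by simp
    have g1: "2 * real p * real s * ln (real p) < real g"
      unfolding g_def using nn by linarith
    have "real g \<le> 2 * real p * real s * ln (real p) + 2"
      unfolding g_def using nn by linarith
    also have "\<dots> \<le> 2 * T powr (1 - d / 4) * real s * ln T + 2 * real s"
      using p(3) pT p8 lnp s(2) by (intro add_mono mult_mono) auto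
    also have "\<dots> = (2 * T powr (1 - d / 4) * ln T + 2) * real s" by (simp add: algebra_simps)
    also have "\<dots> \<le> (d / 8) * T * real s" using T1 by (rule mult_right_mono) simp
    finally have g2: "real g \<le> (d / 8) * real k" by (simp add: k mult_ac)
    have shrink: "real p ^ m * (1 - 1 / (2 * real p)) ^ g < 1"
    proof -
      have "(1 - 1 / (2 * real p)) ^ g \<le> exp (- (1 / (2 * real p))) ^ g"
        using p8 exp_ge_add_one_self[of "- (1 / (2 * real p))"] by (intro power_mono) auto
      also have "\<dots> = exp (- (real g / (2 * real p)))"
        by (simp flip: exp_of_nat_mult)
      finally have "real p ^ m * (1 - 1 / (2 * real p)) ^ g \<le> real p ^ m * exp (- (real g / (2 * real p)))"
        by (intro mult_left_mono) auto
      also have "\<dots> = exp (real m * ln (real p) - real g / (2 * real p))"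
      proof -
        have "real p ^ m = exp (real m * ln (real p))" using p8 by (simp add: exp_of_nat_mult)
        then show ?thesis by (simp only: mult_exp_exp add_uminus_conv_diff)
      qed
      also have "\<dots> < 1"
      proof -
        have "real m * ln (real p) \<le> real s * ln (real p)"
          using lnp m(1) by (intro mult_right_mono) auto
        also have "\<dots> < real g / (2 * real p)" using g1 p8 by (simp add: field_simps)
        finally show ?thesis by simp
      qed
      finally show ?thesis .
    qed

    define R where "R = real p ^ (m - 2) * (real p - 1) / 4"
    have "real p ^ (m - 1) / 8 = real p ^ (m - 2) * (real p / 2) / 4"
    proof -
      have "m - 1 = Suc (m - 2)" using m(2) by simp
      then show ?thesis by (simp only: power_Suc) simp
    qed
    also have "\<dots> \<le> R"
      unfolding R_def using p8 by (intro divide_right_mono mult_left_mono) auto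
    finally have R1: "real p ^ (m - 1) / 8 \<le> R" .
    have "real p ^ 1 \<le> real p ^ (m - 1)" using p8 m(2) by (intro power_increasing) auto
    then have R_ge: "1 \<le> R" using R1 p8 by (simp only: power_one_right)
    have "T powr ((1 - d / 2) * (real s - 3)) = (T powr (1 - d / 2)) ^ (m - 1)"
    proof -
      have "real s - 3 = real (m - 1)" using m by simp
      then show ?thesis using T3 by (simp only: powr_powr[symmetric]) (simp add: powr_realpow)
    qed
    also have "\<dots> \<le> real p ^ (m - 1)" using p(2) by (intro power_mono) auto
    finally have "T powr ((1 - d / 2) * (real s - 3)) / 8 \<le> R" using R1 by simp
    \<comment> \<open>The exponent \<open>1 - d / 8\<close> sets aside
      \<open>R powr ((d / 8) * k)\<close> to pay for the good steps.\<close>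
    then have "(T powr ((1 - d / 2) * (real s - 3)) / 8) powr (1 - d / 8) \<le> R powr (1 - d / 8)"
      using d by (intro powr_mono2) auto
    moreover have "T powr ((1 - d / 2) * (1 - d / 8) * (real s - 3)) / 8 \<le>
        (T powr ((1 - d / 2) * (real s - 3)) / 8) powr (1 - d / 8)"
    proof -
      have "(8 :: real) powr (1 - d / 8) \<le> 8 powr 1" using d by (intro powr_mono) auto
      then have "T powr ((1 - d / 2) * (1 - d / 8) * (real s - 3)) / 8 \<le>
          T powr ((1 - d / 2) * (1 - d / 8) * (real s - 3)) / 8 powr (1 - d / 8)"
        by (intro divide_left_mono) auto
      then show ?thesis by (simp add: powr_divide powr_powr mult_ac)
    qed
    \<comment> \<open>The exponents differ by at least
      \<open>3 / 8 * (d * s) - 4 + 15 / 8 * d\<close> plus 1, and \<open>d * s \<ge> 12\<close>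
      leaves a full factor \<open>T \<ge> 16\<close>, which covers the 2 on the left and the 8 on
      the right.\<close>
    moreover have "2 * T powr ((1 - d) * real s) \<le> T powr ((1 - d / 2) * (1 - d / 8) * (real s - 3)) / 8"
    proof -
      have "(1 - 5 * d / 8) * (real s - 3) \<le> (1 - d / 2) * (1 - d / 8) * (real s - 3)"
        using s24 by (intro mult_right_mono) (auto simp: algebra_simps)
      moreover have "(1 - d) * real s + 1 \<le> (1 - 5 * d / 8) * (real s - 3)"
      proof -
        have "(1 - 5 * d / 8) * (real s - 3) - ((1 - d) * real s + 1) =
            3 / 8 * (d * real s) - 4 + 15 / 8 * d"
          by (simp add: field_simps)
        then show ?thesis using ds d(1) by linarith
      qed
      ultimately have "T powr ((1 - d) * real s + 1) \<le> T powr ((1 - d / 2) * (1 - d / 8) * (real s - 3))"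
        using T3 by (intro powr_mono) auto
      moreover have "16 * T powr ((1 - d) * real s) \<le> T * T powr ((1 - d) * real s)"
        using T3 by (intro mult_right_mono) auto
      moreover have "T powr ((1 - d) * real s + 1) = T * T powr ((1 - d) * real s)"
        using T3 by (simp add: powr_add)
      ultimately show ?thesis by simp
    qed
    ultimately have R2: "2 * T powr ((1 - d) * real s) \<le> R powr (1 - d / 8)" by linarith

    show "(real k / real s) powr ((1 - \<delta>) * real s) \<le> real (ramsey_number s k)"
    proof (rule ccontr)
      assume "\<not> ?thesis"
      then have "real r < T powr ((1 - \<delta>) * real s)" by (simp add: r_def T_def)
      also have "\<dots> \<le> T powr ((1 - d) * real s)"
        using T3 d(3) by (intro powr_mono mult_right_mono) auto
      finally have "2 * real r < R powr (1 - d / 8)" using R2 by simp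
      then have "(2 * real r) ^ k < (R powr (1 - d / 8)) ^ k"
        using sk by (intro power_strict_mono) auto
      also have "\<dots> = R powr ((1 - d / 8) * real k)"
        using R_ge by (simp only: powr_powr[symmetric]) (simp add: powr_realpow)
      finally have "(2 * real r) ^ k * R ^ g < R powr ((1 - d / 8) * real k) * R ^ g"
        using R_ge by (intro mult_strict_right_mono) auto
      \<comment> \<open>By \<open>g2\<close> the factor \<open>R ^ g\<close> fits into the share set
        aside, and the two exponents add up to \<open>k\<close>.\<close>
      also have "\<dots> \<le> R powr ((1 - d / 8) * real k) * R powr ((d / 8) * real k)"
        using R_ge g2 powr_mono[OF g2 R_ge] by (intro mult_left_mono) (auto simp: powr_realpow)
      also have "\<dots> = R powr real k"
      proof -
        have "(1 - d / 8) * real k + (d / 8) * real k = real k" by (simp add: algebra_simps)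
        then show ?thesis by (simp only: powr_add[symmetric])
      qed
      also have "\<dots> = R ^ k" using R_ge by (simp add: powr_realpow)
      finally have "(2 * real r) ^ k * R ^ g < R ^ k" .
      then have "\<not> ramsey_property (m + 2) k r"
        using p(1) m(2) R_ge shrink unfolding R_def by (intro not_ramsey_property)
      then show False
        using ramsey_property_ramsey_number[of s k] by (simp add: m(1) r_def)
    qed
  qed
qed

end
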